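(* We have: (1) DF and DF$^\sharp$ are equivalent. (2) VG and VG$^\sharp$ are equivalent. (3) ODF and ODF$^\sharp$ are equivalent.
   Context: Setting. $O$ is an infinite dimensional separable real Hilbert space with scalar product $\langle\cdot,\cdot\rangle$ and norm $|\cdot|$. $X\subseteq O$ is a dense subspace, itself a Hilbert space with continuous inclusion $X\to O$. $a$ is a continuous symmetric bilinear form on $X$ with $a(u,u)\ge 0$ for all $u\in X$, such that $\langle\cdot,\cdot\rangle+a$ is coercive on $X$; this form is taken as the scalar product of $X$, so $\|u\|^2=|u|^2+a(u,u)$ is the norm of $X$. Define $W=\{u\in X: a(u,u')=0\ \forall u'\in X\}$ and $V=\{u\in X:\langle u,w\rangle=0\ \forall w\in W\}$, so $X=V\oplus W$; $W$ is closed in $O$ and may be infinite dimensional. $\overline V$ is the closure of $V$ in $O$; it is the $O$-orthogonal complement of $W$. $P$ is the $O$-orthogonal projector in $O$ with range $\overline V$ and kernel $W$. It is assumed that the injection $V\to O$ is compact ($V$ carrying the norm of $X$). Discretization. $(X_n)_{n\in\mathbb N}$ is a sequence of finite dimensional subspaces of $X$ satisfying AS: for all $u\in X$, $\lim_{n\to\infty}\inf_{u'\in X_n}\|u-u'\|=0$. Define $W_n=X_n\cap W=\{u\in X_n:a(u,u')=0\ \forall u'\in X_n\}$ and $V_n=\{u\in X_n:\langle u,w\rangle=0\ \forall w\in W_n\}$. Equivalent forms. $\langle\cdot,\cdot\rangle^\sharp$ is a symmetric bilinear form on $O$ and $a^\sharp$ a symmetric bilinear form on $X$ such that for some constants $c,C>0$: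 $c\langle u,u\rangle\le\langle u,u\rangle^\sharp\le C\langle u,u\rangle$ for all $u\in O$, and $c\,a(u,u)\le a^\sharp(u,u)\le C\,a(u,u)$ for all $u\in X$. Write $|u|_\sharp^2=\langle u,u\rangle^\sharp$ and $\|u\|_\sharp^2=\langle u,u\rangle^\sharp+a^\sharp(u,u)$. The forms $a$ and $a^\sharp$ have the same kernel $W$. Set $V^\sharp=\{u\in X:\langle u,w\rangle^\sharp=0\ \forall w\in W\}$, $\overline{V}^\sharp$ its closure in $O$, $P^\sharp$ the projector in $O$ with range $\overline V^\sharp$ and kernel $W$, and $V_n^\sharp=\{u\in X_n:\langle u,w\rangle^\sharp=0\ \forall w\in W_n\}$, so that $X_n=V_n^\sharp\oplus W_n$. Conditions. DF: there is $C>0$ such that $|v|^2\le C\,a(v,v)$ for all $n$ and $v\in V_n$. VG: $\sup_{v\in V_n,v\ne0}\inf_{v'\in V}\|v-v'\|/\|v\|\to0$ as $n\to\infty$ (supremum over the empty set being $0$). ODF: there is $C>0$ such that $|v|\le C|Pv|$ for all $n$ and $v\in V_n$. DF$^\sharp$, VG$^\sharp$, ODF$^\sharp$ are the same conditions formulated with $\langle\cdot,\cdot\rangle^\sharp$ and $a^\sharp$, i.e. with $a,|\cdot|,\|\cdot\|,V,V_n,P$ replaced by $a^\sharp,|\cdot|_\sharp,\|\cdot\|_\sharp,V^\sharp,V_n^\sharp,P^\sharp$ respectively. *)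

theory Defs
  imports "HOL-Analysis.Analysis"
begin

definition symmetric_bilinear_on :: "'o::real_vector set \<Rightarrow> ('o \<Rightarrow> 'o \<Rightarrow> real) \<Rightarrow> bool" where
  "symmetric_bilinear_on S b \<longleftrightarrow>
     (\<forall>u\<in>S. \<forall>v\<in>S. b u v = b v u) \<and>
     (\<forall>u\<in>S. \<forall>v\<in>S. \<forall>w\<in>S. b (u + v) w = b u w + b v w) \<and>
     (\<forall>r. \<forall>u\<in>S. \<forall>v\<in>S. b (r *\<^sub>R u) v = r * b u v)"

definition finite_dimensional :: "'o::real_vector set \<Rightarrow> bool" where
  "finite_dimensional S \<longleftrightarrow> (\<exists>B. finite B \<and> span B = S)"

text \<open>
  Throughout, \<open>h\<close> is a scalar product on the whole space (either \<open>inner\<close> or an equivalent form),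
  and \<open>a\<close> is a form of which only the values on a subspace \<open>X\<close> matter.
\<close>

definition form_norm :: "('o \<Rightarrow> 'o \<Rightarrow> real) \<Rightarrow> 'o \<Rightarrow> real" where
  "form_norm h u = sqrt (h u u)"

definition energy_norm :: "('o \<Rightarrow> 'o \<Rightarrow> real) \<Rightarrow> ('o \<Rightarrow> 'o \<Rightarrow> real) \<Rightarrow> 'o \<Rightarrow> real" where
  "energy_norm h a u = sqrt (h u u + a u u)"

definition form_kernel :: "'o set \<Rightarrow> ('o \<Rightarrow> 'o \<Rightarrow> real) \<Rightarrow> 'o set" where
  "form_kernel X a = {u \<in> X. \<forall>u'\<in>X. a u u' = 0}"

definition orth_in :: "('o \<Rightarrow> 'o \<Rightarrow> real) \<Rightarrow> 'o set \<Rightarrow> 'o set \<Rightarrow> 'o set" where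
  "orth_in h X W = {u \<in> X. \<forall>w\<in>W. h u w = 0}"

text \<open>Meaningful when \<open>R\<close> and \<open>K\<close> are complementary subspaces; the projector is then unique.\<close>

definition projector :: "'o::real_vector set \<Rightarrow> 'o set \<Rightarrow> 'o \<Rightarrow> 'o" where
  "projector R K = (THE P. linear P \<and> P \<circ> P = P \<and> range P = R \<and> {u. P u = 0} = K)"

text \<open>
  The Hilbert space structure of \<open>X\<close> is the one given by the scalar product \<open>inner + a\<close>.
  For its norm, the inclusion of \<open>X\<close> in the ambient space and the form \<open>a\<close> are
  automatically continuous, and \<open>inner + a\<close> is trivially coercive, so that only
  completeness has to be required.
\<close>

locale hilbert_setting =
  fixes X :: "'o::{real_inner, banach} set"
    and a :: "'o \<Rightarrow> 'o \<Rightarrow> real"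
  assumes infinite_dimensional: "\<not> finite_dimensional (UNIV :: 'o set)"
    and separable: "\<exists>D :: 'o set. countable D \<and> closure D = UNIV"
    and subspace_X: "subspace X"
    and dense_X: "closure X = UNIV"
    and bilinear_a: "symmetric_bilinear_on X a"
    and nonneg_a: "\<And>u. u \<in> X \<Longrightarrow> 0 \<le> a u u"
    and complete_X:
      "\<And>s. (\<And>k. s k \<in> X) \<Longrightarrow>
        (\<And>e. e > 0 \<Longrightarrow> \<exists>N::nat. \<forall>j\<ge>N. \<forall>k\<ge>N. energy_norm inner a (s j - s k) < e) \<Longrightarrow>
        \<exists>l\<in>X. (\<lambda>k. energy_norm inner a (s k - l)) \<longlonglongrightarrow> 0"
    and compact_V:
      "compact (closure {v \<in> orth_in inner X (form_kernel X a). energy_norm inner a v \<le> 1})"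

locale galerkin_setting = hilbert_setting X a
  for X :: "'o::{real_inner, banach} set" and a :: "'o \<Rightarrow> 'o \<Rightarrow> real" +
  fixes Xn :: "nat \<Rightarrow> 'o set"
  assumes subspace_Xn: "\<And>n. subspace (Xn n)"
    and Xn_subset: "\<And>n. Xn n \<subseteq> X"
    and Xn_finite_dimensional: "\<And>n. finite_dimensional (Xn n)"
    and approximation:
      "\<And>u. u \<in> X \<Longrightarrow> (\<lambda>n. INF u'\<in>Xn n. energy_norm inner a (u - u')) \<longlonglongrightarrow> 0"

definition equivalent_forms ::
  "'o::real_inner set \<Rightarrow> ('o \<Rightarrow> 'o \<Rightarrow> real) \<Rightarrow> ('o \<Rightarrow> 'o \<Rightarrow> real) \<Rightarrow> ('o \<Rightarrow> 'o \<Rightarrow> real) \<Rightarrow> bool" where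
  "equivalent_forms X a h' a' \<longleftrightarrow>
     symmetric_bilinear_on UNIV h' \<and> symmetric_bilinear_on X a' \<and>
     (\<exists>c>0. \<exists>C>0.
        (\<forall>u. c * inner u u \<le> h' u u \<and> h' u u \<le> C * inner u u) \<and>
        (\<forall>u\<in>X. c * a u u \<le> a' u u \<and> a' u u \<le> C * a u u))"

text \<open>
  In the following conditions \<open>W\<close> is the common kernel on \<open>X\<close> of the forms under consideration.
  Since these are positive semidefinite, \<open>Xn n \<inter> W\<close> is also the kernel of each of them
  restricted to \<open>Xn n\<close>.
\<close>

definition discrete_V ::
  "('o \<Rightarrow> 'o \<Rightarrow> real) \<Rightarrow> 'o set \<Rightarrow> (nat \<Rightarrow> 'o set) \<Rightarrow> nat \<Rightarrow> 'o set" where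
  "discrete_V h W Xn n = orth_in h (Xn n) (Xn n \<inter> W)"

definition DF ::
  "('o \<Rightarrow> 'o \<Rightarrow> real) \<Rightarrow> ('o \<Rightarrow> 'o \<Rightarrow> real) \<Rightarrow> 'o set \<Rightarrow> (nat \<Rightarrow> 'o set) \<Rightarrow> bool" where
  "DF h a W Xn \<longleftrightarrow>
     (\<exists>C>0. \<forall>n. \<forall>v\<in>discrete_V h W Xn n. (form_norm h v)\<^sup>2 \<le> C * a v v)"

text \<open>
  Inserting \<open>0\<close> only fixes the supremum of the empty set: the quotients lie between \<open>0\<close> and \<open>1\<close>
  because \<open>0\<close> is a candidate for \<open>v'\<close>.
\<close>

definition VG ::
  "('o::real_vector \<Rightarrow> 'o \<Rightarrow> real) \<Rightarrow> ('o \<Rightarrow> 'o \<Rightarrow> real) \<Rightarrow> 'o set \<Rightarrow> 'o set \<Rightarrow> (nat \<Rightarrow> 'o set) \<Rightarrow> bool" where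
  "VG h a X W Xn \<longleftrightarrow>
     (\<lambda>n. Sup (insert 0
        ((\<lambda>v. INF v'\<in>orth_in h X W. energy_norm h a (v - v') / energy_norm h a v) `
          (discrete_V h W Xn n - {0})))) \<longlonglongrightarrow> 0"

definition ODF ::
  "('o::real_normed_vector \<Rightarrow> 'o \<Rightarrow> real) \<Rightarrow> 'o set \<Rightarrow> 'o set \<Rightarrow> (nat \<Rightarrow> 'o set) \<Rightarrow> bool" where
  "ODF h X W Xn \<longleftrightarrow>
     (\<exists>C>0. \<forall>n. \<forall>v\<in>discrete_V h W Xn n.
        form_norm h v \<le> C * form_norm h (projector (closure (orth_in h X W)) W v))"

end

theory Submission imports Defs
begin

text \<open>
  Let \<open>Q\<close> and \<open>Q'\<close> be the orthogonal projectors onto the common kernel \<open>W\<close> for the two scalar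
  products, so that the projectors onto the closures of \<open>V\<close> and \<open>V'\<close> are \<open>1 - Q\<close> and \<open>1 - Q'\<close>.
  A vector \<open>v\<close> of \<open>Vn'\<close> splits as \<open>v = u + w\<close> with \<open>u \<in> Vn\<close>, \<open>w \<in> Wn\<close>; then \<open>v\<close> is the second
  orthogonal projection of \<open>u\<close>, whence \<open>|v|' \<le> |u|'\<close>, while \<open>a u u = a v v\<close> and
  \<open>u - Q u = (1 - Q) (v - Q' v)\<close>. This transfers DF and ODF.

  VG says that \<open>|Q u| \<le> \<epsilon>n \<parallel>u\<parallel>\<close> on \<open>Vn\<close>. It implies that elements of \<open>W\<close> are approximated by \<open>Wn\<close>,
  uniformly on relatively compact sets such as the set of the \<open>Q' (u - Q u)\<close> with \<open>\<parallel>u\<parallel> \<le> 1\<close>. Since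
  \<open>Q' v = Q' (u - Q u) + Q u + w\<close> and \<open>v\<close> is orthogonal to \<open>Wn\<close> for the second scalar product,
  \<open>|Q' v|'\<^sup>2 = \<langle>Q' v, v\<rangle>' = \<langle>Q' (u - Q u) - y, v\<rangle>' + \<langle>Q u, v\<rangle>'\<close> for any \<open>y \<in> Wn\<close>, which is small.
\<close>

section \<open>Positive semidefinite forms\<close>

locale psd_form =
  fixes S :: "'o::real_vector set" and b :: "'o \<Rightarrow> 'o \<Rightarrow> real"
  assumes subspace: "subspace S"
    and bilinear: "symmetric_bilinear_on S b"
    and nonneg: "u \<in> S \<Longrightarrow> 0 \<le> b u u"
begin

lemma sym: "u \<in> S \<Longrightarrow> v \<in> S \<Longrightarrow> b u v = b v u"
  using bilinear unfolding symmetric_bilinear_on_def by blast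

lemma add_left: "u \<in> S \<Longrightarrow> v \<in> S \<Longrightarrow> w \<in> S \<Longrightarrow> b (u + v) w = b u w + b v w"
  using bilinear unfolding symmetric_bilinear_on_def by blast

lemma scale_left: "u \<in> S \<Longrightarrow> v \<in> S \<Longrightarrow> b (r *\<^sub>R u) v = r * b u v"
  using bilinear unfolding symmetric_bilinear_on_def by blast

lemma mem [simp]:
  "0 \<in> S" "u \<in> S \<Longrightarrow> v \<in> S \<Longrightarrow> u + v \<in> S" "u \<in> S \<Longrightarrow> v \<in> S \<Longrightarrow> u - v \<in> S"
  "u \<in> S \<Longrightarrow> r *\<^sub>R u \<in> S"
  using subspace by (auto intro: subspace_0 subspace_add subspace_diff subspace_scale)

lemma zero_left [simp]: "v \<in> S \<Longrightarrow> b 0 v = 0"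
  using scale_left[of 0 v 0] by simp

lemma diff_left: "u \<in> S \<Longrightarrow> v \<in> S \<Longrightarrow> w \<in> S \<Longrightarrow> b (u - v) w = b u w - b v w"
  using add_left[of "u - v" v w] by simp

lemma add_right: "u \<in> S \<Longrightarrow> v \<in> S \<Longrightarrow> w \<in> S \<Longrightarrow> b w (u + v) = b w u + b w v"
  by (metis add_left sym mem(2))

lemma diff_right: "u \<in> S \<Longrightarrow> v \<in> S \<Longrightarrow> w \<in> S \<Longrightarrow> b w (u - v) = b w u - b w v"
  by (metis diff_left sym mem(3))

lemma scale_right: "u \<in> S \<Longrightarrow> v \<in> S \<Longrightarrow> b v (r *\<^sub>R u) = r * b v u"
  by (metis scale_left sym mem(4))

lemma add_square:
  "u \<in> S \<Longrightarrow> v \<in> S \<Longrightarrow> b (u + v) (u + v) = b u u + 2 * b u v + b v v"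
  by (simp add: add_left add_right sym[of v u])

lemma diff_square:
  "u \<in> S \<Longrightarrow> v \<in> S \<Longrightarrow> b (u - v) (u - v) = b u u - 2 * b u v + b v v"
  by (simp add: diff_left diff_right sym[of v u])

lemma scale_square: "u \<in> S \<Longrightarrow> b (r *\<^sub>R u) (r *\<^sub>R u) = r\<^sup>2 * b u u"
  by (simp add: scale_left scale_right power2_eq_square)

text \<open>The quadratic \<open>t \<mapsto> b (u + t *\<^sub>R v) (u + t *\<^sub>R v)\<close> is
  nonnegative. If \<open>b v v > 0\<close>, evaluate it at its minimum; if \<open>b v v = 0\<close>
  it is affine in \<open>t\<close>, so its slope vanishes.\<close>

lemma Cauchy_Schwarz_square:
  assumes u: "u \<in> S" and v: "v \<in> S"
  shows "(b u v)\<^sup>2 \<le> b u u * b v v"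
proof -
  have q: "0 \<le> b u u + 2 * t * b u v + t\<^sup>2 * b v v" for t
    using nonneg[of "u + t *\<^sub>R v"] u v
    by (simp add: add_square scale_left scale_right power2_eq_square mult.assoc)
  show ?thesis
  proof (cases "b v v = 0")
    case True
    have "b u v = 0"
    proof (rule ccontr)
      assume "b u v \<noteq> 0"
      then show False
        \<comment> \<open>At this \<open>t\<close> the affine function takes the value -1.\<close>
        using q[of "- (b u u + 1) / (2 * b u v)"] True by (simp add: field_simps)
    qed
    then show ?thesis using True by simp
  next
    case False
    then have pos: "b v v > 0" using nonneg[OF v] by simp
    have "0 \<le> b u u - (b u v)\<^sup>2 / b v v"
      using q[of "- b u v / b v v"] pos
      by (simp add: power2_eq_square field_simps)
    then show ?thesis using pos by (simp add: field_simps)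
  qed
qed

lemma Cauchy_Schwarz:
  assumes "u \<in> S" "v \<in> S"
  shows "\<bar>b u v\<bar> \<le> form_norm b u * form_norm b v"
proof -
  have "\<bar>b u v\<bar> = sqrt ((b u v)\<^sup>2)" by simp
  also have "\<dots> \<le> sqrt (b u u * b v v)"
    using Cauchy_Schwarz_square[OF assms] real_sqrt_le_mono by blast
  finally show ?thesis by (simp add: form_norm_def real_sqrt_mult)
qed

lemma form_norm_nonneg [simp]: "u \<in> S \<Longrightarrow> 0 \<le> form_norm b u"
  by (simp add: form_norm_def nonneg)

lemma form_norm_square: "u \<in> S \<Longrightarrow> (form_norm b u)\<^sup>2 = b u u"
  by (simp add: form_norm_def nonneg)

lemma form_norm_triangle:
  assumes u: "u \<in> S" and v: "v \<in> S"
  shows "form_norm b (u + v) \<le> form_norm b u + form_norm b v"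
proof (rule power2_le_imp_le)
  show "(form_norm b (u + v))\<^sup>2 \<le> (form_norm b u + form_norm b v)\<^sup>2"
    using Cauchy_Schwarz[OF u v] u v
    by (simp add: form_norm_square power2_sum add_square)
qed (use u v in simp)

lemma null_orthogonal: "u \<in> S \<Longrightarrow> v \<in> S \<Longrightarrow> b u u = 0 \<Longrightarrow> b u v = 0"
  using Cauchy_Schwarz_square[of u v] by simp

text \<open>By Cauchy-Schwarz a null vector is orthogonal to all of \<open>S\<close>, so membership
  in the kernel can be tested on the diagonal.\<close>

lemma form_kernel_eq: "form_kernel S b = {u \<in> S. b u u = 0}"
  unfolding form_kernel_def using null_orthogonal by auto

lemma add_null_square: "u \<in> S \<Longrightarrow> w \<in> S \<Longrightarrow> b w w = 0 \<Longrightarrow> b (u + w) (u + w) = b u u"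
  by (simp add: add_square sym[of u w] null_orthogonal)

lemma subspace_form_kernel: "subspace (form_kernel S b)"
  unfolding form_kernel_def subspace_def by (auto simp: add_left scale_left)

section \<open>Orthogonal projection onto finite dimensional subspaces\<close>

lemma orthogonal_span:
  assumes "x \<in> S" "B \<subseteq> S" "\<And>w. w \<in> B \<Longrightarrow> b x w = 0" "w \<in> span B"
  shows "b x w = 0"
proof -
  have "subspace {w \<in> S. b x w = 0}"
    unfolding subspace_def
    using assms(1) by (auto simp: add_right scale_right sym[of x 0])
  then have "span B \<subseteq> {w \<in> S. b x w = 0}"
    by (intro span_minimal) (use assms in auto)
  then show ?thesis using assms(4) by blast
qed

text \<open>Gram-Schmidt by induction on \<open>B\<close>: the new vector \<open>y\<close> is
  replaced by its residual \<open>y - q\<close> over \<open>span B\<close>, and the projection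
  \<open>p\<close> of \<open>x\<close> is corrected along that residual.\<close>

lemma exists_projection_span:
  assumes "finite B" "B \<subseteq> S" "x \<in> S"
  shows "\<exists>p\<in>span B. \<forall>w\<in>span B. b (x - p) w = 0"
  using assms
proof (induction B arbitrary: x rule: finite_induct)
  case empty
  then show ?case by (simp add: sym[of x 0])
next
  case (insert y B)
  have sp: "span B \<subseteq> S"
    using insert.prems subspace by (intro span_minimal) auto
  obtain p where p: "p \<in> span B" "\<forall>w\<in>span B. b (x - p) w = 0"
    using insert.IH[of x] insert.prems by auto
  obtain q where q: "q \<in> span B" "\<forall>w\<in>span B. b (y - q) w = 0"
    using insert.IH[of y] insert.prems by auto
  \<comment> \<open>The form may be degenerate. If \<open>b (y - q) (y - q) = 0\<close>, the
    division yields \<open>t = 0\<close>, and \<open>b (x - p) (y - q)\<close> vanishes as well, so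
    the equation for \<open>t\<close> holds in all cases.\<close>
  define t where "t = b (x - p) (y - q) / b (y - q) (y - q)"
  have S: "x \<in> S" "y \<in> S" "p \<in> S" "q \<in> S"
    using insert.prems p q sp by auto
  have t: "t * b (y - q) (y - q) = b (x - p) (y - q)"
    using null_orthogonal[of "y - q" "x - p"] sym[of "y - q" "x - p"] S
    by (cases "b (y - q) (y - q) = 0") (auto simp: t_def)
  define r where "r = p + t *\<^sub>R (y - q)"
  have eq: "x - r = (x - p) - t *\<^sub>R (y - q)" by (simp add: r_def)
  have rS: "r \<in> S" using S by (simp add: r_def)
  have orth: "b (x - r) w = 0" if "w \<in> span B" for w
    unfolding eq using that S sp p(2) q(2) by (subst diff_left) (auto simp: scale_left)
  have "b (x - r) (y - q) = 0"
    unfolding eq using S t by (subst diff_left) (auto simp: scale_left)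
  then have "b (x - r) y = 0"
    using orth[OF q(1)] S rS by (simp add: diff_right)
  then have base: "b (x - r) w = 0" if "w \<in> insert y B" for w
    using that orth span_base by blast
  have "b (x - r) w = 0" if "w \<in> span (insert y B)" for w
    using orthogonal_span[of "x - r" "insert y B" w] base that insert.prems rS S(1) by simp
  moreover have "r \<in> span (insert y B)"
  proof -
    have "span B \<subseteq> span (insert y B)" "y \<in> span (insert y B)"
      by (simp_all add: span_mono subset_insertI span_base)
    then show ?thesis
      unfolding r_def using p(1) q(1) by (meson span_add span_scale span_diff subsetD)
  qed
  ultimately show ?case by (intro bexI[of _ r]) simp_all
qed

end

lemma subspace_finite_dimensional:
  assumes "subspace M" "M \<subseteq> F" "finite_dimensional F"
  shows "finite_dimensional M"
proof -
  obtain T where T: "finite T" "span T = F"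
    using assms(3) unfolding finite_dimensional_def by blast
  obtain B where B: "B \<subseteq> M" "independent B" "M \<subseteq> span B"
    using maximal_independent_subset[of M] by blast
  have "finite B"
    using independent_span_bound[OF T(1) B(2)] B(1) assms(2) T(2) by blast
  moreover have "span B = M"
    using B assms(1) span_minimal[of B M] by blast
  ultimately show ?thesis unfolding finite_dimensional_def by blast
qed

section \<open>Scalar products equivalent to the given one\<close>

text \<open>The projection is characterised by orthogonality of the residual. For an
  \<open>h\<close> equivalent to the ambient scalar product and a closed subspace \<open>W\<close>,
  such a point exists and is unique.\<close>

definition orth_proj :: "('o::real_vector \<Rightarrow> 'o \<Rightarrow> real) \<Rightarrow> 'o set \<Rightarrow> 'o \<Rightarrow> 'o" where
  "orth_proj h W x = (THE p. p \<in> W \<and> (\<forall>w\<in>W. h (x - p) w = 0))"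

locale equivalent_inner = h: psd_form UNIV h
  for h :: "'o::{real_inner, banach} \<Rightarrow> 'o \<Rightarrow> real" +
  assumes equivalent:
    "\<exists>c>0. \<exists>C>0. \<forall>u. c * inner u u \<le> h u u \<and> h u u \<le> C * inner u u"
begin

lemma form_norm_bounds:
  obtains k K where "k > 0" "K > 0"
    "\<And>u. k * norm u \<le> form_norm h u" "\<And>u. form_norm h u \<le> K * norm u"
proof -
  obtain c C where cC: "c > 0" "C > 0"
    "\<And>u. c * inner u u \<le> h u u" "\<And>u. h u u \<le> C * inner u u"
    using equivalent by blast
  have "sqrt c * norm u \<le> form_norm h u" "form_norm h u \<le> sqrt C * norm u" for u
    using real_sqrt_le_mono[OF cC(3)[of u]] real_sqrt_le_mono[OF cC(4)[of u]]
    by (simp_all add: form_norm_def real_sqrt_mult norm_eq_sqrt_inner)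
  then show ?thesis using that[of "sqrt c" "sqrt C"] cC by simp
qed

lemma definite: "h u u = 0 \<longleftrightarrow> u = 0"
proof
  assume "h u u = 0"
  moreover obtain k K where "k > 0" "k * norm u \<le> form_norm h u"
    using form_norm_bounds by metis
  ultimately have "k * norm u \<le> 0" by (simp add: form_norm_def)
  then show "u = 0" using \<open>k > 0\<close> by (simp add: mult_le_0_iff)
qed simp

text \<open>A sequence in \<open>M\<close> minimising the squared \<open>h\<close>-distance to
  \<open>x\<close> is Cauchy by the parallelogram identity. The norms being equivalent, it converges
  in the complete ambient space; its limit is a minimiser, and minimality along each line
  \<open>p + t *\<^sub>R w\<close> gives orthogonality.\<close>

lemma exists_projection:
  assumes M: "subspace M" "closed M"
  shows "\<exists>p\<in>M. \<forall>w\<in>M. h (x - p) w = 0"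
proof -
  obtain k K where k: "k > 0" "K > 0"
    and kK: "\<And>u. k * norm u \<le> form_norm h u" "\<And>u. form_norm h u \<le> K * norm u"
    using form_norm_bounds by blast
  define q where "q u = h (x - u) (x - u)" for u
  define d where "d = (INF u\<in>M. q u)"
  have q0: "0 \<le> q u" for u unfolding q_def by (simp add: h.nonneg)
  have ne: "M \<noteq> {}" using M(1) subspace_0 by blast
  have d_le: "d \<le> q u" if "u \<in> M" for u
    unfolding d_def by (rule cINF_lower[OF _ that]) (use q0 in \<open>auto intro!: bdd_belowI2\<close>)
  have "\<exists>u\<in>M. q u < d + 1 / real (Suc n)" for n
    using cINF_less_iff[OF ne, of q "d + 1 / real (Suc n)"] q0
    by (force simp: d_def intro!: bdd_belowI2)
  then obtain s where s: "\<And>n. s n \<in> M" "\<And>n. q (s n) < d + 1 / real (Suc n)"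
    by metis
  \<comment> \<open>Parallelogram identity for \<open>x - u\<close> and \<open>x - v\<close>; the
    midpoint \<open>m\<close> belongs to \<open>M\<close>, whence
    \<open>q m \<ge> d\<close>.\<close>
  have par: "h (u - v) (u - v) \<le> 2 * (q u - d) + 2 * (q v - d)" if "u \<in> M" "v \<in> M" for u v
  proof -
    define m where "m = (1/2) *\<^sub>R (u + v)"
    have "m \<in> M" using that M(1) by (simp add: m_def subspace_add subspace_scale)
    then have "d \<le> q m" by (rule d_le)
    have "x - m = (1/2) *\<^sub>R ((x - u) + (x - v))"
      by (simp add: m_def algebra_simps) (metis scaleR_half_double scaleR_right_distrib)
    then have "4 * q m = h ((x - u) + (x - v)) ((x - u) + (x - v))"
      unfolding q_def by (simp only: h.scale_square[OF UNIV_I]) (simp add: power2_eq_square)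
    moreover have "h (u - v) (u - v) = h ((x - v) - (x - u)) ((x - v) - (x - u))"
      by simp
    ultimately have "4 * q m + h (u - v) (u - v) = 2 * q u + 2 * q v"
      unfolding q_def by (simp only: h.add_square h.diff_square UNIV_I h.sym[of "x - v" "x - u"]) simp
    then show ?thesis using \<open>d \<le> q m\<close> by simp
  qed
  have "Cauchy s"
  proof (rule metric_CauchyI)
    fix e :: real assume e: "e > 0"
    \<comment> \<open>If both values of \<open>q\<close> exceed \<open>d\<close> by less than
      \<open>r\<close>, then \<open>par\<close> bounds the squared \<open>h\<close>-norm of the
      difference by \<open>4 * r\<close>, that is \<open>(k * e)\<^sup>2\<close>.\<close>
    define r where "r = (k * e)\<^sup>2 / 4"
    have "r > 0" using e k by (simp add: r_def)
    then obtain N where N: "inverse (real (Suc N)) < r"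
      using reals_Archimedean by blast
    have close: "q (s n) - d < r" if "n \<ge> N" for n
    proof -
      have "1 / real (Suc n) \<le> inverse (real (Suc N))"
        using that by (simp add: divide_simps)
      then show ?thesis using s(2)[of n] N by linarith
    qed
    have "dist (s i) (s j) < e" if "i \<ge> N" "j \<ge> N" for i j
    proof -
      have "(form_norm h (s i - s j))\<^sup>2 < (k * e)\<^sup>2"
        using par[OF s(1) s(1), of i j] close[OF that(1)] close[OF that(2)]
        by (simp add: h.form_norm_square r_def)
      then have "form_norm h (s i - s j) < k * e"
        using k e by (simp add: power2_less_imp_less)
      then have "k * norm (s i - s j) < k * e" using kK(1) le_less_trans by blast
      then show ?thesis using k by (simp add: dist_norm)
    qed
    then show "\<exists>N. \<forall>i\<ge>N. \<forall>j\<ge>N. dist (s i) (s j) < e" by blast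
  qed
  then obtain p where p: "s \<longlonglongrightarrow> p" using Cauchy_convergent convergent_def by blast
  have pM: "p \<in> M" using M(2) s(1) p closed_sequentially by blast
  have "q p \<le> d"
  proof -
    have "(\<lambda>n. form_norm h (s n - p)) \<longlonglongrightarrow> 0"
    proof (rule Lim_null_comparison)
      show "\<forall>\<^sub>F n in sequentially. norm (form_norm h (s n - p)) \<le> K * norm (s n - p)"
        using kK(2) by simp
      show "(\<lambda>n. K * norm (s n - p)) \<longlonglongrightarrow> 0"
        using tendsto_mult_right_zero tendsto_norm_zero LIM_zero p by blast
    qed
    moreover have "(\<lambda>n. sqrt (d + 1 / real (Suc n))) \<longlonglongrightarrow> sqrt (d + 0)"
      using LIMSEQ_inverse_real_of_nat by (intro tendsto_intros) (simp add: inverse_eq_divide)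
    ultimately have lim: "(\<lambda>n. sqrt (d + 1 / real (Suc n)) + form_norm h (s n - p)) \<longlonglongrightarrow> sqrt d + 0"
      by (intro tendsto_add) simp_all
    have "form_norm h (x - p) \<le> sqrt (d + 1 / real (Suc n)) + form_norm h (s n - p)" for n
    proof -
      have "form_norm h (x - p) \<le> form_norm h (x - s n) + form_norm h (s n - p)"
        using h.form_norm_triangle[of "x - s n" "s n - p"] by simp
      moreover have "form_norm h (x - s n) \<le> sqrt (d + 1 / real (Suc n))"
        using s(2)[of n] by (auto simp: form_norm_def q_def intro!: real_sqrt_le_mono)
      ultimately show ?thesis by simp
    qed
    then have "form_norm h (x - p) \<le> sqrt d"
      using LIMSEQ_le_const[OF lim] by auto
    then show ?thesis by (simp add: form_norm_def q_def)
  qed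
  have "h (x - p) w = 0" if w: "w \<in> M" for w
  proof (cases "w = 0")
    case False
    \<comment> \<open>This \<open>t\<close> minimises \<open>q (p + t *\<^sub>R w)\<close>; the gain
      over \<open>q p\<close> is \<open>(h (x - p) w)\<^sup>2 / h w w\<close>, which must therefore
      be zero.\<close>
    define t where "t = h (x - p) w / h w w"
    have pos: "h w w > 0" using False definite h.nonneg[of w] by (simp add: less_le)
    have "p + t *\<^sub>R w \<in> M" using M(1) w pM by (simp add: subspace_add subspace_scale)
    then have "q p \<le> q (p + t *\<^sub>R w)" using d_le \<open>q p \<le> d\<close> order_trans by blast
    moreover have "q (p + t *\<^sub>R w) = q p - (h (x - p) w)\<^sup>2 / h w w"
    proof -
      have "q (p + t *\<^sub>R w) = h ((x - p) - t *\<^sub>R w) ((x - p) - t *\<^sub>R w)"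
        by (simp add: q_def algebra_simps)
      also have "\<dots> = q p - 2 * (t * h (x - p) w) + t\<^sup>2 * h w w"
        unfolding q_def
        by (subst h.diff_square) (simp_all add: h.scale_left h.scale_right power2_eq_square)
      finally show ?thesis using pos by (simp add: t_def power2_eq_square)
    qed
    ultimately have "(h (x - p) w)\<^sup>2 / h w w \<le> 0" by simp
    then show ?thesis using pos by (simp add: divide_le_0_iff)
  qed (simp add: h.sym[of _ 0])
  then show ?thesis using pM by blast
qed

section \<open>The orthogonal projector onto a closed subspace\<close>

context
  fixes M :: "'o set"
  assumes M: "subspace M" "closed M"
begin

abbreviation (input) "pM \<equiv> orth_proj h M"

lemma orth_proj_unique:
  assumes "p \<in> M" "\<And>w. w \<in> M \<Longrightarrow> h (x - p) w = 0"
  shows "pM x = p"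
  unfolding orth_proj_def
proof (rule the_equality)
  fix r assume r: "r \<in> M \<and> (\<forall>w\<in>M. h (x - r) w = 0)"
  then have "r - p \<in> M" using assms(1) M(1) subspace_diff by blast
  then have "h ((x - p) - (x - r)) (r - p) = 0"
    using r assms(2) by (subst h.diff_left) auto
  then show "r = p" by (simp add: definite)
qed (use assms in blast)

lemma orth_proj_mem [simp]: "pM x \<in> M" 
  and orth_proj_orth: "w \<in> M \<Longrightarrow> h (x - pM x) w = 0"
  using exists_projection[OF M, of x] orth_proj_unique by (metis, metis)

lemma orth_proj_id: "w \<in> M \<Longrightarrow> pM w = w"
  by (rule orth_proj_unique) auto

lemma linear_orth_proj: "linear pM"
proof (rule linearI)
  fix x y r
  show "pM (x + y) = pM x + pM y"
  proof (rule orth_proj_unique)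
    fix w assume "w \<in> M"
    then have "h ((x - pM x) + (y - pM y)) w = 0"
      by (subst h.add_left) (auto simp: orth_proj_orth)
    then show "h (x + y - (pM x + pM y)) w = 0" by (simp add: algebra_simps)
  qed (use M(1) subspace_add orth_proj_mem in blast)
  show "pM (r *\<^sub>R x) = r *\<^sub>R pM x"
  proof (rule orth_proj_unique)
    fix w assume "w \<in> M"
    then have "h (r *\<^sub>R (x - pM x)) w = 0"
      by (subst h.scale_left) (auto simp: orth_proj_orth)
    then show "h (r *\<^sub>R x - r *\<^sub>R pM x) w = 0" by (simp add: algebra_simps)
  qed (use M(1) subspace_scale orth_proj_mem in blast)
qed

lemma orth_proj_pythagoras: "h x x = h (x - pM x) (x - pM x) + h (pM x) (pM x)"
  using h.add_square[of "x - pM x" "pM x"] orth_proj_orth[OF orth_proj_mem, of x x] by simp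

lemma form_norm_orth_proj_le: "form_norm h (pM x) \<le> form_norm h x"
  and form_norm_orth_compl_le: "form_norm h (x - pM x) \<le> form_norm h x"
  using orth_proj_pythagoras[of x] h.nonneg[of "x - pM x"] h.nonneg[of "pM x"]
  by (simp_all add: form_norm_def)

lemma bounded_linear_orth_proj: "bounded_linear pM"
proof -
  obtain k K where k: "k > 0"
    and kK: "\<And>u. k * norm u \<le> form_norm h u" "\<And>u. form_norm h u \<le> K * norm u"
    using form_norm_bounds by metis
  have "norm (pM x) \<le> norm x * (K / k)" for x
    using order_trans[OF kK(1)[of "pM x"] order_trans[OF form_norm_orth_proj_le kK(2)]] k
    by (simp add: field_simps)
  then show ?thesis
    using linear_orth_proj linear_add linear_scale by (intro bounded_linear_intro) blast+
qed

lemma orth_proj_eq_0: "pM x = 0 \<longleftrightarrow> (\<forall>w\<in>M. h x w = 0)"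
  using orth_proj_orth[of _ x] orth_proj_unique[of 0 x] M(1) subspace_0 by auto

text \<open>The kernel of the continuous projector is closed, which gives one inclusion. For the
  other, approximate \<open>x\<close> from the dense space \<open>X\<close> and subtract
  projections: the residuals stay in \<open>X\<close> because \<open>M \<subseteq> X\<close>, and
  they tend to \<open>x - pM x = x\<close>.\<close>

lemma closure_orth_in:
  assumes "subspace X" "closure X = UNIV" "M \<subseteq> X"
  shows "closure (orth_in h X M) = {x. pM x = 0}"
proof
  have "closed {x. pM x = 0}"
    using bounded_linear_orth_proj
    by (intro closed_Collect_eq linear_continuous_on continuous_on_const)
  moreover have "orth_in h X M \<subseteq> {x. pM x = 0}"
    by (auto simp: orth_in_def orth_proj_eq_0)
  ultimately show "closure (orth_in h X M) \<subseteq> {x. pM x = 0}"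
    by (rule closure_minimal[rotated])
  show "{x. pM x = 0} \<subseteq> closure (orth_in h X M)"
  proof
    fix x assume "x \<in> {x. pM x = 0}"
    obtain s where s: "\<And>n. s n \<in> X" "s \<longlonglongrightarrow> x"
      using assms(2) closure_sequential[of x X] by auto
    have "s n - pM (s n) \<in> orth_in h X M" for n
      using s(1) assms(1,3) orth_proj_orth orth_proj_mem
      by (auto simp: orth_in_def intro!: subspace_diff)
    moreover have "(\<lambda>n. s n - pM (s n)) \<longlonglongrightarrow> x - pM x"
      using s(2) bounded_linear_orth_proj bounded_linear.tendsto tendsto_diff by blast
    ultimately show "x \<in> closure (orth_in h X M)"
      using \<open>x \<in> {x. pM x = 0}\<close> closure_sequential by fastforce
  qed
qed

text \<open>A linear idempotent is determined by its range and kernel: it fixes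
  \<open>x - pM x\<close> and annihilates \<open>pM x\<close>.\<close>

lemma projector_eq:
  assumes "subspace X" "closure X = UNIV" "M \<subseteq> X"
  shows "projector (closure (orth_in h X M)) M = (\<lambda>x. x - pM x)"
  unfolding closure_orth_in[OF assms] projector_def
proof (rule the_equality)
  have QQ: "pM (pM x) = pM x" for x by (simp add: orth_proj_id)
  have QP: "pM (x - pM x) = 0" for x
    using QQ linear_orth_proj by (simp add: linear_diff)
  have "{x. x - pM x = 0} = M"
  proof (intro set_eqI iffI)
    show "x \<in> M" if "x \<in> {x. x - pM x = 0}" for x
      using that orth_proj_mem[of x] by simp
  qed (simp add: orth_proj_id)
  moreover have "range (\<lambda>x. x - pM x) = {x. pM x = 0}"
  proof (intro set_eqI iffI)
    show "x \<in> range (\<lambda>x. x - pM x)" if "x \<in> {x. pM x = 0}" for x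
      using that by (intro range_eqI[of _ _ x]) simp
  qed (use QP in auto)
  ultimately show "linear (\<lambda>x. x - pM x) \<and> (\<lambda>x. x - pM x) \<circ> (\<lambda>x. x - pM x) = (\<lambda>x. x - pM x)
      \<and> range (\<lambda>x. x - pM x) = {x. pM x = 0} \<and> {u. u - pM u = 0} = M"
    using QP linear_compose_sub[OF linear_ident linear_orth_proj] by (auto simp: fun_eq_iff)
  fix P assume P: "linear P \<and> P \<circ> P = P \<and> range P = {x. pM x = 0} \<and> {u. P u = 0} = M"
  show "P = (\<lambda>x. x - pM x)"
  proof
    fix x
    have PP: "P (P y) = P y" for y using P by (metis comp_apply)
    have "x - pM x \<in> range P" using P QP[of x] by blast
    then have "P (x - pM x) = x - pM x" using PP by auto
    moreover have "P (pM x) = 0" using P orth_proj_mem[of x] by blast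
    moreover have "P (x - pM x) = P x - P (pM x)" using P linear_diff by blast
    ultimately show "P x = x - pM x" by simp
  qed
qed

end

end

section \<open>The kernel and the compact complement\<close>

lemma energy_norm_ge_norm:
  "0 \<le> a u u \<Longrightarrow> norm u \<le> energy_norm inner a u"
  by (simp add: energy_norm_def norm_eq_sqrt_inner)

context hilbert_setting
begin

abbreviation "W \<equiv> form_kernel X a"

sublocale a: psd_form X a
  using subspace_X bilinear_a nonneg_a by unfold_locales

lemma energy_norm_scale:
  assumes "u \<in> X"
  shows "energy_norm inner a (r *\<^sub>R u) = \<bar>r\<bar> * energy_norm inner a u"
proof -
  have "inner (r *\<^sub>R u) (r *\<^sub>R u) + a (r *\<^sub>R u) (r *\<^sub>R u) = r\<^sup>2 * (inner u u + a u u)"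
    using assms by (simp add: a.scale_square power2_eq_square algebra_simps)
  then show ?thesis by (simp add: energy_norm_def real_sqrt_mult)
qed

lemma W_subset: "W \<subseteq> X"
  by (auto simp: form_kernel_def)

text \<open>On differences of elements of \<open>W\<close> the energy norm is the ambient norm, so a
  sequence in \<open>W\<close> converging in the ambient space is Cauchy in \<open>X\<close>.
  Completeness of \<open>X\<close> puts its limit in \<open>X\<close>, and energy convergence forces
  \<open>a\<close> to vanish on it.\<close>

lemma closed_W: "closed W"
  unfolding closed_sequential_limits
proof (intro allI impI)
  fix s l assume A: "(\<forall>n::nat. s n \<in> W) \<and> s \<longlonglongrightarrow> l"
  have sX: "s n \<in> X" and a0: "a (s n) (s n) = 0" for n
    using A by (auto simp: a.form_kernel_eq)
  have "\<exists>N. \<forall>j\<ge>N. \<forall>k\<ge>N. energy_norm inner a (s j - s k) < e" if "e > 0" for e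
  proof -
    have "a (s j - s k) (s j - s k) = 0" for j k
      using sX a0 by (simp add: a.diff_square a.null_orthogonal)
    then have "energy_norm inner a (s j - s k) = dist (s j) (s k)" for j k
      by (simp add: energy_norm_def dist_norm norm_eq_sqrt_inner)
    then show ?thesis
      using A that LIMSEQ_imp_Cauchy metric_CauchyD by metis
  qed
  then obtain l' where l': "l' \<in> X" "(\<lambda>k. energy_norm inner a (s k - l')) \<longlonglongrightarrow> 0"
    using complete_X[of s] sX by blast
  have "(\<lambda>k. s k - l') \<longlonglongrightarrow> 0"
    by (rule Lim_null_comparison[OF always_eventually l'(2)])
      (use sX l' in \<open>auto intro!: energy_norm_ge_norm a.nonneg\<close>)
  then have "l' = l" using A LIMSEQ_unique LIM_zero_cancel by blast
  have "sqrt (a l' l') \<le> energy_norm inner a (s k - l')" for k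
    using sX a0 l'(1) by (simp add: energy_norm_def a.diff_square a.null_orthogonal)
  then have "sqrt (a l' l') \<le> 0"
    using LIMSEQ_le_const[OF l'(2)] by blast
  then have "a l' l' = 0" using a.nonneg[OF l'(1)] by simp
  then show "l \<in> W" using l'(1) \<open>l' = l\<close> by (simp add: a.form_kernel_eq)
qed

end

text \<open>The pair \<open>(h, b)\<close> is arbitrary among those equivalent to
  \<open>(inner, a)\<close>. Since \<open>(inner, a)\<close> is itself such a pair, each result
  below serves both the original and the modified forms.\<close>

locale hilbert_forms = hilbert_setting X a
  for X :: "'o::{real_inner, banach} set" and a +
  fixes h b :: "'o \<Rightarrow> 'o \<Rightarrow> real"
  assumes forms: "equivalent_forms X a h b"
begin

lemma bounds:
  obtains c C where "c > 0" "C > 0"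
    "\<And>u. c * inner u u \<le> h u u" "\<And>u. h u u \<le> C * inner u u"
    "\<And>u. u \<in> X \<Longrightarrow> c * a u u \<le> b u u" "\<And>u. u \<in> X \<Longrightarrow> b u u \<le> C * a u u"
  using forms unfolding equivalent_forms_def by blast

sublocale equivalent_inner h
proof
  obtain c C where c: "c > 0" "C > 0" "\<And>u. c * inner u u \<le> h u u" "\<And>u. h u u \<le> C * inner u u"
    using bounds by metis
  then show "\<exists>c>0. \<exists>C>0. \<forall>u. c * inner u u \<le> h u u \<and> h u u \<le> C * inner u u" by blast
  show "symmetric_bilinear_on UNIV h"
    using forms by (simp add: equivalent_forms_def)
  show "0 \<le> h u u" for u
    using c(1) c(3)[of u] inner_ge_zero[of u] mult_nonneg_nonneg order_trans
    by (metis less_imp_le)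
qed simp

sublocale b: psd_form X b
proof
  show "symmetric_bilinear_on X b"
    using forms by (simp add: equivalent_forms_def)
  obtain c where "c > 0" "\<And>u. u \<in> X \<Longrightarrow> c * a u u \<le> b u u"
    using bounds by metis
  then show "0 \<le> b u u" if "u \<in> X" for u
    using a.nonneg that mult_nonneg_nonneg order_trans by (metis less_imp_le)
qed (rule subspace_X)

abbreviation "N \<equiv> form_norm h"
abbreviation "E \<equiv> energy_norm h b"
abbreviation "Q \<equiv> orth_proj h W"

lemmas W_sc = a.subspace_form_kernel closed_W

section \<open>Energy norm and projection onto the kernel\<close>

lemma b_W: "w \<in> W \<Longrightarrow> b w w = 0"
proof -
  assume w: "w \<in> W"
  obtain C where "\<And>u. u \<in> X \<Longrightarrow> b u u \<le> C * a u u" using bounds by metis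
  then have "b w w \<le> 0" using w by (force simp: a.form_kernel_eq)
  then show "b w w = 0" using b.nonneg[of w] w W_subset by force
qed

lemma E_bounds:
  obtains k K where "k > 0" "K > 0"
    "\<And>u. u \<in> X \<Longrightarrow> k * energy_norm inner a u \<le> E u"
    "\<And>u. u \<in> X \<Longrightarrow> E u \<le> K * energy_norm inner a u"
proof -
  obtain c C where c: "c > 0" "C > 0"
    "\<And>u. c * inner u u \<le> h u u" "\<And>u. h u u \<le> C * inner u u"
    "\<And>u. u \<in> X \<Longrightarrow> c * a u u \<le> b u u" "\<And>u. u \<in> X \<Longrightarrow> b u u \<le> C * a u u"
    using bounds by metis
  have "sqrt c * energy_norm inner a u \<le> E u" "E u \<le> sqrt C * energy_norm inner a u"
    if "u \<in> X" for u
    unfolding energy_norm_def real_sqrt_mult[symmetric]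
    using c(3,4)[of u] c(5,6)[OF that] by (simp_all add: distrib_left)
  then show ?thesis using that[of "sqrt c" "sqrt C"] c by simp
qed

lemma E_square: "u \<in> X \<Longrightarrow> (E u)\<^sup>2 = h u u + b u u"
  by (simp add: energy_norm_def h.nonneg b.nonneg)

lemma E_nonneg: "u \<in> X \<Longrightarrow> 0 \<le> E u"
  by (simp add: energy_norm_def h.nonneg b.nonneg)

lemma N_le_E: "u \<in> X \<Longrightarrow> N u \<le> E u"
  by (simp add: energy_norm_def form_norm_def b.nonneg)

lemma E_pos: "u \<in> X \<Longrightarrow> u \<noteq> 0 \<Longrightarrow> 0 < E u"
  using definite[of u] h.nonneg[of u] b.nonneg[of u]
  by (simp add: energy_norm_def)

lemma Q_mem: "Q u \<in> W"
  by (rule orth_proj_mem[OF W_sc])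

lemma Q_mem_X: "Q u \<in> X"
  using Q_mem W_subset by blast

lemma linear_Q: "linear Q"
  by (rule linear_orth_proj[OF W_sc])

lemma b_compl: "u \<in> X \<Longrightarrow> w \<in> W \<Longrightarrow> b (u - w) (u - w) = b u u"
  using b.add_null_square[of "u - w" w] b_W[of w] W_subset by auto

lemma E_compl_square: "u \<in> X \<Longrightarrow> (E u)\<^sup>2 = (E (u - Q u))\<^sup>2 + (N (Q u))\<^sup>2"
  using orth_proj_pythagoras[OF W_sc, of u] b_compl[OF _ Q_mem, of u u] Q_mem_X[of u]
  by (simp add: E_square h.form_norm_square)

lemma E_compl_le: "u \<in> X \<Longrightarrow> E (u - Q u) \<le> E u"
  using E_compl_square[of u] E_nonneg[of u] power2_le_imp_le[of "E (u - Q u)" "E u"] by simp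

lemma compl_mem_orth_in: "u \<in> X \<Longrightarrow> u - Q u \<in> orth_in h X W"
  using Q_mem_X orth_proj_orth[OF W_sc] by (auto simp: orth_in_def)

text \<open>The minimum is attained at \<open>v - Q v\<close>. For any competitor \<open>v'\<close>
  one has \<open>Q v' = 0\<close>, hence \<open>Q v = Q (v - v')\<close>, and \<open>Q\<close> does
  not increase \<open>N\<close>, which is bounded by \<open>E\<close>.\<close>

lemma distance_to_orth_in:
  assumes v: "v \<in> X" "v \<noteq> 0"
  shows "(INF v'\<in>orth_in h X W. E (v - v') / E v) = N (Q v) / E v"
proof (rule cInf_eq_minimum)
  have "E (v - (v - Q v)) = N (Q v)"
    using b_W[OF Q_mem] by (simp add: energy_norm_def form_norm_def)
  then show "N (Q v) / E v \<in> (\<lambda>v'. E (v - v') / E v) ` orth_in h X W"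
    using compl_mem_orth_in[OF v(1)] by (intro image_eqI[of _ _ "v - Q v"]) auto
  fix r assume "r \<in> (\<lambda>v'. E (v - v') / E v) ` orth_in h X W"
  then obtain v' where v': "v' \<in> orth_in h X W" "r = E (v - v') / E v" by blast
  then have "v' \<in> X" by (simp add: orth_in_def)
  have "Q v' = 0"
    using v'(1) by (simp add: orth_proj_eq_0[OF W_sc] orth_in_def)
  then have "Q (v - v') = Q v" using linear_diff[OF linear_Q] by simp
  then have "N (Q v) \<le> N (v - v')" using form_norm_orth_proj_le[OF W_sc, of "v - v'"] by simp
  also have "\<dots> \<le> E (v - v')" using v(1) \<open>v' \<in> X\<close> by (simp add: N_le_E)
  finally show "N (Q v) / E v \<le> r"
    using v'(2) E_pos[OF v] by (simp add: divide_right_mono)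
qed

end

lemma equivalent_forms_refl:
  assumes "hilbert_setting X a"
  shows "equivalent_forms X a inner a"
proof -
  have "symmetric_bilinear_on UNIV inner"
    by (auto simp: symmetric_bilinear_on_def inner_commute inner_add_left inner_add_right)
  moreover have "symmetric_bilinear_on X a"
    using assms by (rule hilbert_setting.bilinear_a)
  ultimately show ?thesis
    unfolding equivalent_forms_def by (auto intro!: exI[of _ 1])
qed

text \<open>As \<open>T\<close> vanishes on \<open>W\<close>, \<open>T u\<close> only depends on the
  component of \<open>u\<close> in \<open>V\<close>. The unit ball of \<open>V\<close> is relatively
  compact, so its image under the continuous map \<open>T\<close> is totally bounded.\<close>

lemma (in hilbert_setting) finite_net:
  fixes T :: "'o \<Rightarrow> 'o"
  assumes T: "bounded_linear T" "\<And>w. w \<in> W \<Longrightarrow> T w = 0" and e: "e > 0"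
  obtains F where "finite F" "F \<subseteq> range T"
    "\<And>u. u \<in> X \<Longrightarrow> energy_norm inner a u \<le> 1 \<Longrightarrow> \<exists>z\<in>F. norm (T u - z) < e"
proof -
  interpret i: hilbert_forms X a inner a
    using equivalent_forms_refl[OF hilbert_setting_axioms] by unfold_locales
  let ?S = "{v \<in> orth_in inner X W. energy_norm inner a v \<le> 1}"
  have comp: "compact (T ` closure ?S)"
    using compact_V T(1) by (intro compact_continuous_image linear_continuous_on)
  obtain F where F: "finite F" "F \<subseteq> T ` closure ?S" "T ` closure ?S \<subseteq> (\<Union>z\<in>F. ball z e)"
    using seq_compact_imp_totally_bounded[OF compact_imp_seq_compact[OF comp]] e by auto
  have "\<exists>z\<in>F. norm (T u - z) < e" if u: "u \<in> X" "energy_norm inner a u \<le> 1" for u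
  proof -
    have "u - i.Q u \<in> ?S"
      using i.compl_mem_orth_in[OF u(1)] i.E_compl_le[OF u(1)] u(2) by simp
    moreover have "T (u - i.Q u) = T u"
      using T(2)[OF i.Q_mem] T(1) by (simp add: bounded_linear.linear linear_diff)
    ultimately have "T u \<in> T ` closure ?S"
      using closure_subset by (metis (no_types, lifting) imageI subsetD)
    then obtain z where "z \<in> F" "T u \<in> ball z e" using F(3) by blast
    then show ?thesis by (auto simp: dist_norm norm_minus_commute)
  qed
  moreover have "F \<subseteq> range T" using F(2) by blast
  ultimately show ?thesis using that[of F] F(1) by simp
qed

section \<open>Discrete spaces\<close>

locale galerkin_forms = galerkin_setting X a Xn + hilbert_forms X a h b
  for X :: "'o::{real_inner, banach} set" and a Xn h b
begin

abbreviation "Wn n \<equiv> Xn n \<inter> W"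
abbreviation "Vn \<equiv> discrete_V h W Xn"

lemma Vn_subset: "v \<in> Vn n \<Longrightarrow> v \<in> Xn n"
  by (simp add: discrete_V_def orth_in_def)

lemma Vn_X: "v \<in> Vn n \<Longrightarrow> v \<in> X"
  using Vn_subset Xn_subset by blast

lemma Vn_orth: "v \<in> Vn n \<Longrightarrow> w \<in> Wn n \<Longrightarrow> h v w = 0"
  unfolding discrete_V_def orth_in_def by blast

lemma split_Xn:
  assumes "x \<in> Xn n"
  obtains w where "w \<in> Wn n" "x - w \<in> Vn n"
proof -
  have "subspace (Wn n)"
    using subspace_Xn W_sc(1) by (rule subspace_inter)
  then have "finite_dimensional (Wn n)"
    using subspace_finite_dimensional[OF _ _ Xn_finite_dimensional] by blast
  then obtain B where B: "finite B" "span B = Wn n"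
    unfolding finite_dimensional_def by blast
  obtain w where w: "w \<in> Wn n" "\<forall>y\<in>Wn n. h (x - w) y = 0"
    using h.exists_projection_span[OF B(1), of x] B(2) by auto
  have "x - w \<in> Xn n"
    using assms w(1) subspace_Xn subspace_diff by blast
  then show ?thesis
    using that[of w] w by (simp add: discrete_V_def orth_in_def)
qed

text \<open>The distance formula turns the gap into the supremum of \<open>N (Q v) / E v\<close>.
  The product form avoids both the quotient and the supremum.\<close>

lemma VG_iff:
  "VG h b X W Xn \<longleftrightarrow>
    (\<forall>e>0. \<forall>\<^sub>F n in sequentially. \<forall>v\<in>Vn n. N (Q v) \<le> e * E v)"
proof -
  define R where "R n = insert 0 ((\<lambda>v. INF v'\<in>orth_in h X W. E (v - v') / E v) ` (Vn n - {0}))" for n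
  have R: "R n = insert 0 ((\<lambda>v. N (Q v) / E v) ` (Vn n - {0}))" for n
    unfolding R_def
    by (intro arg_cong[where f = "insert 0"] image_cong refl distance_to_orth_in) (auto dest: Vn_X)
  have ratio_le: "N (Q v) / E v \<le> e \<longleftrightarrow> N (Q v) \<le> e * E v" if "v \<in> Vn n - {0}" for v n e
    using that E_pos[of v] Vn_X[of v n] by (simp add: pos_divide_le_eq)
  \<comment> \<open>Quotients bounded by 1 make the real supremum an actual least upper
    bound.\<close>
  have "N (Q v) \<le> E v" if "v \<in> Vn n" for v n
    using form_norm_orth_proj_le[OF W_sc, of v] N_le_E[OF Vn_X[OF that]] by linarith
  then have "r \<le> 1" if "r \<in> R n" for r n
    using that ratio_le[of _ n 1] by (auto simp: R)
  then have bdd: "bdd_above (R n)" for n by (rule bdd_aboveI)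
  have Sup_le: "Sup (R n) \<le> e \<longleftrightarrow> (\<forall>v\<in>Vn n. N (Q v) \<le> e * E v)" if "e > 0" for n e
  proof -
    have "Sup (R n) \<le> e \<longleftrightarrow> (\<forall>r\<in>R n. r \<le> e)"
      by (rule cSup_le_iff) (use bdd in \<open>auto simp: R\<close>)
    also have "\<dots> \<longleftrightarrow> (\<forall>v\<in>Vn n - {0}. N (Q v) \<le> e * E v)"
      using that ratio_le[of _ n e] by (simp add: R)
    \<comment> \<open>The excluded vector 0 can be restored, since the product inequality is trivial
      there.\<close>
    also have "\<dots> \<longleftrightarrow> (\<forall>v\<in>Vn n. N (Q v) \<le> e * E v)"
    proof -
      have "N (Q 0) \<le> e * E 0"
        using that by (simp add: linear_0[OF linear_Q] form_norm_def energy_norm_def b.scale_left)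
      then show ?thesis by blast
    qed
    finally show ?thesis .
  qed
  have Sup_nonneg: "0 \<le> Sup (R n)" for n
    using cSup_upper[OF _ bdd, of 0 n] by (simp add: R)
  have "VG h b X W Xn \<longleftrightarrow> (\<lambda>n. Sup (R n)) \<longlonglongrightarrow> 0"
    by (simp add: VG_def R_def)
  also have "\<dots> \<longleftrightarrow> (\<forall>e>0. \<forall>\<^sub>F n in sequentially. Sup (R n) \<le> e)"
  proof (intro iffI allI impI)
    fix e :: real assume "(\<lambda>n. Sup (R n)) \<longlonglongrightarrow> 0" "e > 0"
    then have "\<forall>\<^sub>F n in sequentially. Sup (R n) < e" by (rule order_tendstoD(2))
    then show "\<forall>\<^sub>F n in sequentially. Sup (R n) \<le> e" by eventually_elim simp
  next
    assume A: "\<forall>e>0. \<forall>\<^sub>F n in sequentially. Sup (R n) \<le> e"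
    show "(\<lambda>n. Sup (R n)) \<longlonglongrightarrow> 0"
    proof (rule tendstoI)
      fix e :: real assume "e > 0"
      then have "\<forall>\<^sub>F n in sequentially. Sup (R n) \<le> e / 2"
        using A half_gt_zero by blast
      then show "\<forall>\<^sub>F n in sequentially. dist (Sup (R n)) 0 < e"
      proof eventually_elim
        case (elim n)
        then show ?case using Sup_nonneg[of n] \<open>e > 0\<close> by simp
      qed
    qed
  qed
  also have "\<dots> \<longleftrightarrow> (\<forall>e>0. \<forall>\<^sub>F n in sequentially. \<forall>v\<in>Vn n. N (Q v) \<le> e * E v)"
    using Sup_le by simp
  finally show ?thesis .
qed

section \<open>Approximation by the discrete spaces\<close>

lemma approximation_E:
  assumes u: "u \<in> X" and e: "e > 0"
  shows "\<forall>\<^sub>F n in sequentially. \<exists>x\<in>Xn n. E (u - x) < e"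
proof -
  obtain K where K: "K > 0" "\<And>u. u \<in> X \<Longrightarrow> E u \<le> K * energy_norm inner a u"
    using E_bounds by metis
  have "\<forall>\<^sub>F n in sequentially. (INF x\<in>Xn n. energy_norm inner a (u - x)) < e / K"
    using order_tendstoD(2)[OF approximation[OF u]] e K(1) by simp
  then show ?thesis
  proof eventually_elim
    case (elim n)
    have ne: "Xn n \<noteq> {}" using subspace_0[OF subspace_Xn] by blast
    have bdd: "bdd_below ((\<lambda>x. energy_norm inner a (u - x)) ` Xn n)"
      using u Xn_subset[of n]
      by (intro bdd_belowI2[of _ 0]) (auto simp: energy_norm_def a.nonneg subset_iff)
    obtain x where x: "x \<in> Xn n" "energy_norm inner a (u - x) < e / K"
      using cINF_less_iff[OF ne bdd] elim by blast
    have "E (u - x) \<le> K * energy_norm inner a (u - x)"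
      using K(2)[of "u - x"] u x(1) Xn_subset[of n] by auto
    also have "\<dots> < e" using x(2) K(1) by (simp add: field_simps)
    finally show ?case using x(1) by blast
  qed
qed

text \<open>Splitting a good approximant of \<open>z \<in> W\<close> as \<open>u + y\<close> with \<open>u \<in> Vn n\<close>, the vertical part
  \<open>u - Q u\<close> is small since \<open>z\<close> has none, and VG then makes \<open>u\<close> itself small.\<close>

lemma approximation_W:
  assumes VG: "VG h b X W Xn" and z: "z \<in> W" and e: "e > 0"
  shows "\<forall>\<^sub>F n in sequentially. \<exists>y\<in>Wn n. norm (z - y) < e"
proof -
  obtain k where k: "k > 0" "\<And>u. k * norm u \<le> N u" using form_norm_bounds by metis
  \<comment> \<open>The error in \<open>N\<close> is at most \<open>d\<close> from the approximant
    of \<open>z\<close> and \<open>2 * d\<close> from \<open>u\<close>; the factor \<open>k\<close>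
    returns to the ambient norm.\<close>
  define d where "d = k * e / 3"
  have d: "d > 0" using k(1) e by (simp add: d_def)
  have zX: "z \<in> X" using z W_subset by blast
  \<comment> \<open>The ratio 1/2 lets the horizontal part of \<open>u\<close> be absorbed:
    \<open>(E u)\<^sup>2 \<le> d\<^sup>2 + (E u)\<^sup>2 / 4\<close> yields
    \<open>E u \<le> 2 * d\<close>.\<close>
  have "\<forall>\<^sub>F n in sequentially. \<forall>v\<in>Vn n. N (Q v) \<le> 1/2 * E v"
    using VG[unfolded VG_iff, THEN spec, of "1/2"] by simp
  then show ?thesis
    using approximation_E[OF zX d]
  proof eventually_elim
    case (elim n)
    then obtain x where x: "x \<in> Xn n" "E (z - x) < d" by blast
    obtain y where y: "y \<in> Wn n" "x - y \<in> Vn n" using split_Xn[OF x(1)] by blast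
    define u where "u = x - y"
    have X: "x \<in> X" "u \<in> X" using x(1) Xn_subset y(2) Vn_X by (auto simp: u_def)
    have "Q z = z" "Q y = y" using z y(1) orth_proj_id[OF W_sc] by auto
    then have "z - x - Q (z - x) = - (u - Q u)"
      by (simp add: u_def linear_diff[OF linear_Q])
    then have "E (z - x - Q (z - x)) = E (u - Q u)"
      using h.scale_square[of "u - Q u" "-1"] b.scale_square[of "u - Q u" "-1"] X Q_mem_X
      by (simp add: energy_norm_def)
    then have "E (u - Q u) \<le> d"
      using E_compl_le[of "z - x"] zX X x(2) by simp
    then have "(E (u - Q u))\<^sup>2 \<le> d\<^sup>2"
      using E_nonneg X Q_mem_X by (intro power_mono) auto
    moreover have "(N (Q u))\<^sup>2 \<le> (1/2 * E u)\<^sup>2"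
      using elim(1) y(2) by (intro power_mono) (auto simp: u_def)
    ultimately have "(E u)\<^sup>2 \<le> d\<^sup>2 + (1/2 * E u)\<^sup>2" using E_compl_square[OF X(2)] by simp
    moreover have "(1/2 * E u)\<^sup>2 = (E u)\<^sup>2 / 4" "(2 * d)\<^sup>2 = 4 * d\<^sup>2"
      by (simp_all add: power_mult_distrib power_divide)
    ultimately have "(E u)\<^sup>2 \<le> (2 * d)\<^sup>2"
      using zero_le_power2[of d] by linarith
    then have "E u \<le> 2 * d" using d power2_le_imp_le[of "E u" "2 * d"] by simp
    have "k * norm (z - y) \<le> N (z - y)" by (rule k(2))
    also have "\<dots> \<le> N (z - x) + N u"
      using h.form_norm_triangle[of "z - x" u] by (simp add: u_def)
    also have "\<dots> < d + 2 * d"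
      using N_le_E[of "z - x"] N_le_E[of u] zX X x(2) \<open>E u \<le> 2 * d\<close> by simp
    also have "\<dots> = k * e" by (simp add: d_def)
    finally show ?case using y(1) k(1) by auto
  qed
qed

text \<open>A finite net of radius \<open>e / 2\<close> for the image of the energy unit ball
  reduces the claim to finitely many points of \<open>W\<close>, which are eventually approximated
  simultaneously within \<open>e / 2\<close>. Scaling extends the bound to all of
  \<open>X\<close>.\<close>

lemma approximation_W_uniform:
  fixes T :: "'o \<Rightarrow> 'o"
  assumes VG: "VG h b X W Xn" and e: "e > 0"
    and T: "bounded_linear T" "\<And>w. w \<in> W \<Longrightarrow> T w = 0" "range T \<subseteq> W"
  shows "\<forall>\<^sub>F n in sequentially. \<forall>u\<in>X. \<exists>y\<in>Wn n. norm (T u - y) \<le> e * energy_norm inner a u"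
proof -
  obtain F where F: "finite F" "F \<subseteq> range T"
    "\<And>u. u \<in> X \<Longrightarrow> energy_norm inner a u \<le> 1 \<Longrightarrow> \<exists>z\<in>F. norm (T u - z) < e / 2"
    using finite_net[OF T(1,2), of "e / 2"] e by auto
  have "\<forall>\<^sub>F n in sequentially. \<forall>z\<in>F. \<exists>y\<in>Wn n. norm (z - y) < e / 2"
    by (rule eventually_ball_finite[OF F(1)])
      (use F(2) T(3) approximation_W[OF VG, of _ "e / 2"] e in \<open>simp add: subset_iff\<close>)
  then show ?thesis
  proof eventually_elim
    case (elim n)
    show ?case
    proof
      fix u assume u: "u \<in> X"
      let ?E = "energy_norm inner a u"
      have sub: "subspace (Wn n)"
        using subspace_Xn W_sc(1) by (rule subspace_inter)
      show "\<exists>y\<in>Wn n. norm (T u - y) \<le> e * ?E"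
      proof (cases "u = 0")
        case True
        then show ?thesis
          using subspace_0[OF sub] T(1)
          by (intro bexI[of _ 0]) (auto simp: energy_norm_def linear_0 bounded_linear.linear)
      next
        case False
        then have pos: "?E > 0"
          using energy_norm_ge_norm[of a u] a.nonneg[OF u]
          by (simp add: less_le_trans[of 0 "norm u"])
        define u' where "u' = (1 / ?E) *\<^sub>R u"
        have "energy_norm inner a u' = 1 / ?E * ?E"
          using energy_norm_scale[OF u, of "1 / ?E"] pos by (simp add: u'_def)
        then have "energy_norm inner a u' \<le> 1" using pos by simp
        moreover have "u' \<in> X" using u by (simp add: u'_def)
        ultimately obtain z where z: "z \<in> F" "norm (T u' - z) < e / 2" using F(3) by blast
        obtain y where y: "y \<in> Wn n" "norm (z - y) < e / 2" using elim z(1) by blast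
        have close: "norm (T u' - y) \<le> e"
          using z(2) y(2) norm_triangle_ineq[of "T u' - z" "z - y"] by simp
        have "T u = ?E *\<^sub>R T u'"
          using pos T(1) by (simp add: u'_def bounded_linear.linear linear_scale)
        then have "T u - ?E *\<^sub>R y = ?E *\<^sub>R (T u' - y)"
          by (simp add: scaleR_diff_right)
        then have "norm (T u - ?E *\<^sub>R y) = ?E * norm (T u' - y)"
          using pos by simp
        also have "\<dots> \<le> ?E * e"
          using close pos by (intro mult_left_mono) auto
        finally show ?thesis
          using subspace_scale[OF sub y(1), of ?E] by (metis mult.commute)
      qed
    qed
  qed
qed

end

section \<open>Comparison of two equivalent pairs of forms\<close>

text \<open>The two pairs play symmetric roles, so each transfer is proved in one direction and
  reversed by exchanging them.\<close>

locale galerkin_pair =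
  F1: galerkin_forms X a Xn h1 b1 + F2: galerkin_forms X a Xn h2 b2
  for X :: "'o::{real_inner, banach} set" and a Xn h1 b1 h2 b2
begin

section \<open>Comparison constants\<close>

lemma N_compare:
  obtains C where "C > 0" "\<And>u. F1.N u \<le> C * F2.N u"
proof -
  obtain K where K: "K > 0" "\<And>u. F1.N u \<le> K * norm u" using F1.form_norm_bounds by metis
  obtain k where k: "k > 0" "\<And>u. k * norm u \<le> F2.N u" using F2.form_norm_bounds by metis
  have "F1.N u \<le> K / k * F2.N u" for u
  proof -
    have "K * norm u \<le> K / k * F2.N u"
      using mult_left_mono[OF k(2)[of u], of "K / k"] K(1) k(1) by simp
    then show ?thesis using K(2) order_trans by blast
  qed
  then show ?thesis using that[of "K / k"] K k by simp
qed

lemma E_compare: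
  obtains C where "C > 0" "\<And>u. u \<in> X \<Longrightarrow> F1.E u \<le> C * F2.E u"
proof -
  obtain K where K: "K > 0" "\<And>u. u \<in> X \<Longrightarrow> F1.E u \<le> K * energy_norm inner a u"
    using F1.E_bounds by metis
  obtain k where k: "k > 0" "\<And>u. u \<in> X \<Longrightarrow> k * energy_norm inner a u \<le> F2.E u"
    using F2.E_bounds by metis
  have "F1.E u \<le> K / k * F2.E u" if "u \<in> X" for u
  proof -
    have "K * energy_norm inner a u \<le> K / k * F2.E u"
      using mult_left_mono[OF k(2)[OF that], of "K / k"] K(1) k(1) by simp
    then show ?thesis using K(2)[OF that] order_trans by blast
  qed
  then show ?thesis using that[of "K / k"] K k by simp
qed

lemma b_compare:
  obtains C where "C > 0" "\<And>u. u \<in> X \<Longrightarrow> b1 u u \<le> C * b2 u u"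
proof -
  obtain K where K: "K > 0" "\<And>u. u \<in> X \<Longrightarrow> b1 u u \<le> K * a u u" using F1.bounds by metis
  obtain k where k: "k > 0" "\<And>u. u \<in> X \<Longrightarrow> k * a u u \<le> b2 u u" using F2.bounds by metis
  have "b1 u u \<le> K / k * b2 u u" if "u \<in> X" for u
  proof -
    have "K * a u u \<le> K / k * b2 u u"
      using mult_left_mono[OF k(2)[OF that], of "K / k"] K(1) k(1) by simp
    then show ?thesis using K(2)[OF that] order_trans by blast
  qed
  then show ?thesis using that[of "K / k"] K k by simp
qed

text \<open>Subtracting \<open>w\<close> makes \<open>v\<close> orthogonal to \<open>F1.Wn n\<close>
  for \<open>h1\<close>. Pythagoras for \<open>h2\<close>, where \<open>v\<close> is orthogonal to
  \<open>w\<close>, shows that \<open>F2.N\<close> does not decrease; Pythagoras for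
  \<open>h1\<close>, where \<open>v - w\<close> is orthogonal to \<open>w\<close>, shows that
  \<open>F1.E\<close> does not increase. Kernel vectors do not affect \<open>b1\<close>.\<close>

lemma split_Vn:
  assumes "v \<in> F2.Vn n"
  obtains w where "w \<in> F1.Wn n" "v - w \<in> F1.Vn n" "F2.N v \<le> F2.N (v - w)"
    "F1.E (v - w) \<le> F1.E v" "b1 (v - w) (v - w) = b1 v v" "v - w \<in> X" "v \<in> X"
proof -
  obtain w where w: "w \<in> F1.Wn n" "v - w \<in> F1.Vn n"
    using F1.split_Xn F2.Vn_subset[OF assms] by metis
  have X: "v \<in> X" "v - w \<in> X" using F2.Vn_X[OF assms] F1.Vn_X[OF w(2)] by auto
  have b: "b1 (v - w) (v - w) = b1 v v" using F1.b_compl X(1) w(1) by blast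
  have "h2 v w = 0" using F2.Vn_orth[OF assms w(1)] .
  then have "h2 (v - w) (v - w) = h2 v v + h2 w w" by (simp add: F2.h.diff_square)
  then have N: "F2.N v \<le> F2.N (v - w)" by (simp add: form_norm_def F2.h.nonneg)
  have "h1 (v - w) w = 0" using F1.Vn_orth[OF w(2,1)] .
  then have "h1 v v = h1 (v - w) (v - w) + h1 w w"
    using F1.h.add_square[of "v - w" w] by simp
  then have "F1.E (v - w) \<le> F1.E v" by (simp add: energy_norm_def b F1.h.nonneg)
  then show ?thesis using that w b N X by blast
qed

lemma DF_transfer:
  assumes "DF h1 b1 F1.W Xn"
  shows "DF h2 b2 F1.W Xn"
proof -
  \<comment> \<open>Exchanging the pairs supplies the bound of \<open>F2.N\<close> by
    \<open>F1.N\<close>.\<close>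
  interpret R: galerkin_pair X a Xn h2 b2 h1 b1 ..
  obtain C where C: "C > 0" "\<And>n v. v \<in> F1.Vn n \<Longrightarrow> (F1.N v)\<^sup>2 \<le> C * b1 v v"
    using assms unfolding DF_def by blast
  obtain D where D: "D > 0" "\<And>u. F2.N u \<le> D * F1.N u" using R.N_compare by blast
  obtain B where B: "B > 0" "\<And>u. u \<in> X \<Longrightarrow> b1 u u \<le> B * b2 u u" using b_compare by blast
  have "(F2.N v)\<^sup>2 \<le> D\<^sup>2 * C * B * b2 v v" if v: "v \<in> F2.Vn n" for v n
  proof -
    obtain w where w: "v - w \<in> F1.Vn n" "F2.N v \<le> F2.N (v - w)"
      "b1 (v - w) (v - w) = b1 v v" "v \<in> X"
      using split_Vn[OF v] by metis
    have "(F2.N v)\<^sup>2 \<le> (D * F1.N (v - w))\<^sup>2"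
      using w(2) D(2)[of "v - w"] by (intro power_mono) auto
    also have "\<dots> \<le> D\<^sup>2 * (C * b1 v v)"
      using C(2)[OF w(1)] w(3) by (simp add: power_mult_distrib mult_left_mono)
    also have "\<dots> \<le> D\<^sup>2 * (C * (B * b2 v v))"
      using B(2)[OF w(4)] C(1) by (intro mult_left_mono) auto
    finally show ?thesis by (simp add: mult.assoc)
  qed
  moreover have "D\<^sup>2 * C * B > 0" using B C D by simp
  ultimately show ?thesis unfolding DF_def by blast
qed

lemma ODF_transfer:
  assumes "ODF h1 X F1.W Xn"
  shows "ODF h2 X F1.W Xn"
proof -
  interpret R: galerkin_pair X a Xn h2 b2 h1 b1 ..
  note P1 = F1.projector_eq[OF F1.W_sc F1.subspace_X F1.dense_X F1.W_subset]
  note P2 = F2.projector_eq[OF F1.W_sc F1.subspace_X F1.dense_X F1.W_subset]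
  obtain C where C: "C > 0" "\<And>n v. v \<in> F1.Vn n \<Longrightarrow> F1.N v \<le> C * F1.N (v - F1.Q v)"
    using assms unfolding ODF_def P1 by blast
  obtain D where D: "D > 0" "\<And>u. F2.N u \<le> D * F1.N u" using R.N_compare by blast
  obtain G where G: "G > 0" "\<And>u. F1.N u \<le> G * F2.N u" using N_compare by blast
  have "F2.N v \<le> D * C * G * F2.N (v - F2.Q v)" if v: "v \<in> F2.Vn n" for v n
  proof -
    obtain w where w: "w \<in> F1.Wn n" "v - w \<in> F1.Vn n" "F2.N v \<le> F2.N (v - w)"
      using split_Vn[OF v] by metis
    define s where "s = v - F2.Q v"
    have "F1.Q w = w" "F1.Q (F2.Q v) = F2.Q v"
      using w(1) F2.Q_mem F1.orth_proj_id[OF F1.W_sc] by auto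
    \<comment> \<open>Both \<open>w\<close> and \<open>F2.Q v\<close> lie in the common kernel, so
      removing the \<open>F1.Q\<close> part cancels them.\<close>
    then have eq: "v - w - F1.Q (v - w) = s - F1.Q s"
      by (simp add: s_def linear_diff[OF F1.linear_Q])
    have "F2.N v \<le> D * F1.N (v - w)" using w(3) D(2) order_trans by blast
    also have "\<dots> \<le> D * (C * F1.N (s - F1.Q s))"
      using C(2)[OF w(2)] D(1) by (simp add: eq)
    also have "\<dots> \<le> D * (C * F1.N s)"
      using F1.form_norm_orth_compl_le[OF F1.W_sc, of s] C(1) D(1) by simp
    also have "\<dots> \<le> D * (C * (G * F2.N s))"
      using G(2)[of s] C(1) D(1) by simp
    finally show ?thesis by (simp add: s_def mult.assoc)
  qed
  moreover have "D * C * G > 0" using C D G by simp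
  ultimately show ?thesis unfolding ODF_def P2 by blast
qed

lemma VG_transfer:
  assumes VG: "VG h1 b1 X F1.W Xn"
  shows "VG h2 b2 X F1.W Xn"
  unfolding F2.VG_iff
proof (intro allI impI)
  fix e :: real assume e: "e > 0"
  interpret R: galerkin_pair X a Xn h2 b2 h1 b1 ..
  obtain D where D: "D > 0" "\<And>u. F2.N u \<le> D * F1.N u" using R.N_compare by blast
  obtain B where B: "B > 0" "\<And>u. u \<in> X \<Longrightarrow> F1.E u \<le> B * F2.E u" using E_compare by blast
  obtain K where K: "K > 0" "\<And>u. F2.N u \<le> K * norm u" using F2.form_norm_bounds by metis
  obtain k where k: "k > 0" "\<And>u. u \<in> X \<Longrightarrow> k * energy_norm inner a u \<le> F1.E u"
    using F1.E_bounds by metis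
  \<comment> \<open>The final estimate controls the square of \<open>F2.N (F2.Q v)\<close>, hence
    \<open>e\<^sup>2\<close>. The other factors make \<open>D * e1 * B\<close> and
    \<open>K * e2 * B / k\<close> both equal to \<open>e\<^sup>2 / 2\<close>.\<close>
  define e1 where "e1 = e\<^sup>2 / (2 * D * B)"
  define e2 where "e2 = e\<^sup>2 * k / (2 * K * B)"
  have pos: "e1 > 0" "e2 > 0" using e D B K k by (simp_all add: e1_def e2_def)
  \<comment> \<open>\<open>T\<close> maps into \<open>W\<close> and vanishes on \<open>W\<close>, so
    the uniform approximation by discrete kernels applies to it.\<close>
  define T where "T u = F2.Q (u - F1.Q u)" for u
  have T: "bounded_linear T" "\<And>w. w \<in> F1.W \<Longrightarrow> T w = 0" "range T \<subseteq> F1.W"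
  proof -
    show "bounded_linear T"
      unfolding T_def
      by (intro bounded_linear_compose[OF F2.bounded_linear_orth_proj[OF F1.W_sc]]
          bounded_linear_sub bounded_linear_ident F1.bounded_linear_orth_proj[OF F1.W_sc])
    show "T w = 0" if "w \<in> F1.W" for w
      using that by (simp add: T_def F1.orth_proj_id[OF F1.W_sc] linear_0[OF F2.linear_Q])
    show "range T \<subseteq> F1.W" using F2.Q_mem by (auto simp: T_def)
  qed
  have "\<forall>\<^sub>F n in sequentially. \<forall>v\<in>F1.Vn n. F1.N (F1.Q v) \<le> e1 * F1.E v"
    using VG pos(1) by (simp add: F1.VG_iff)
  moreover have "\<forall>\<^sub>F n in sequentially. \<forall>u\<in>X. \<exists>y\<in>F1.Wn n.
      norm (T u - y) \<le> e2 * energy_norm inner a u"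
    by (rule F1.approximation_W_uniform[OF VG pos(2) T(1) _ T(3)]) (rule T(2))
  ultimately show "\<forall>\<^sub>F n in sequentially. \<forall>v\<in>F2.Vn n. F2.N (F2.Q v) \<le> e * F2.E v"
  proof eventually_elim
    case (elim n)
    show ?case
    proof
      fix v assume v: "v \<in> F2.Vn n"
      obtain w where w: "w \<in> F1.Wn n" "v - w \<in> F1.Vn n" "F1.E (v - w) \<le> F1.E v"
        "v - w \<in> X" "v \<in> X"
        using split_Vn[OF v] by metis
      define u where "u = v - w"
      have uX: "u \<in> X" and uV: "u \<in> F1.Vn n" using w by (auto simp: u_def)
      obtain y where y: "y \<in> F1.Wn n" "norm (T u - y) \<le> e2 * energy_norm inner a u"
        using elim(2) uX by blast
      have Eu: "F1.E u \<le> B * F2.E v" using w(3) B(2)[OF w(5)] by (simp add: u_def)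
      have "F2.Q (F1.Q u) = F1.Q u" "F2.Q w = w"
        using w(1) F1.Q_mem F2.orth_proj_id[OF F1.W_sc] by auto
      \<comment> \<open>Here \<open>v = u + w\<close> and \<open>F2.Q u = T u + F1.Q u\<close>;
        adding and subtracting \<open>y\<close> isolates the discrete kernel vector
        \<open>y + w\<close>, to which \<open>v\<close> is orthogonal for \<open>h2\<close>.\<close>
      then have Qv: "F2.Q v = (T u - y) + F1.Q u + (y + w)"
        using linear_diff[OF F2.linear_Q, of u "F1.Q u"] linear_diff[OF F2.linear_Q, of v w]
        by (simp add: T_def u_def)
      have "y + w \<in> F1.Wn n"
        using y(1) w(1) F1.W_sc(1) F1.subspace_Xn subspace_add by blast
      then have "h2 v (y + w) = 0" by (rule F2.Vn_orth[OF v])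
      then have yw: "h2 (y + w) v = 0" using F2.h.sym[of v "y + w"] by simp
      have "h2 (v - F2.Q v) (F2.Q v) = 0"
        using F2.orth_proj_orth[OF F1.W_sc F2.Q_mem] .
      \<comment> \<open>Replacing one factor \<open>F2.Q v\<close> by \<open>v\<close> makes the
        discrete orthogonality of \<open>v\<close> available.\<close>
      then have "h2 (F2.Q v) (F2.Q v) = h2 (F2.Q v) v"
        using F2.h.sym[of v "F2.Q v"] by (simp add: F2.h.diff_left)
      also have "\<dots> = h2 (T u - y) v + h2 (F1.Q u) v"
        using F2.h.add_left[OF UNIV_I UNIV_I UNIV_I, of "T u - y + F1.Q u" "y + w" v]
          F2.h.add_left[OF UNIV_I UNIV_I UNIV_I, of "T u - y" "F1.Q u" v]
        by (simp only: Qv yw add_0_right)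
      also have "\<dots> \<le> F2.N (T u - y) * F2.N v + F2.N (F1.Q u) * F2.N v"
        using F2.h.Cauchy_Schwarz[of "T u - y" v] F2.h.Cauchy_Schwarz[of "F1.Q u" v] by simp
      also have "\<dots> \<le> (e\<^sup>2 / 2 * F2.E v) * F2.N v + (e\<^sup>2 / 2 * F2.E v) * F2.N v"
      proof (intro add_mono mult_right_mono)
        have "F2.N (T u - y) \<le> K * (e2 * energy_norm inner a u)"
          using K y(2) by (meson mult_le_cancel_left_pos order_trans)
        also have "\<dots> = e\<^sup>2 / (2 * B) * (k * energy_norm inner a u)"
          using K(1) by (simp add: e2_def)
        also have "\<dots> \<le> e\<^sup>2 / (2 * B) * (B * F2.E v)"
          using k(2)[OF uX] Eu B(1) by (intro mult_left_mono) auto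
        also have "\<dots> = e\<^sup>2 / 2 * F2.E v" using B(1) by simp
        finally show "F2.N (T u - y) \<le> e\<^sup>2 / 2 * F2.E v" .
        have "F2.N (F1.Q u) \<le> D * (e1 * F1.E u)"
          using D elim(1) uV by (meson mult_le_cancel_left_pos order_trans)
        also have "\<dots> \<le> D * (e1 * (B * F2.E v))"
          using Eu D(1) pos(1) by simp
        also have "\<dots> = e\<^sup>2 / 2 * F2.E v" using B(1) D(1) by (simp add: e1_def)
        finally show "F2.N (F1.Q u) \<le> e\<^sup>2 / 2 * F2.E v" .
      qed simp_all
      also have "\<dots> = e\<^sup>2 * F2.E v * F2.N v" by simp
      also have "\<dots> \<le> e\<^sup>2 * F2.E v * F2.E v"
        using F2.N_le_E[OF w(5)] F2.E_nonneg[OF w(5)] by (intro mult_left_mono) auto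
      finally have "(F2.N (F2.Q v))\<^sup>2 \<le> (e * F2.E v)\<^sup>2"
        unfolding F2.h.form_norm_square[OF UNIV_I] by (simp add: power2_eq_square mult_ac)
      then show "F2.N (F2.Q v) \<le> e * F2.E v"
        by (rule power2_le_imp_le) (use e F2.E_nonneg[OF w(5)] in simp)
    qed
  qed
qed

end

theorem proposition19:
  fixes X :: "'o::{real_inner, banach} set"
    and a a' h' :: "'o \<Rightarrow> 'o \<Rightarrow> real"
    and Xn :: "nat \<Rightarrow> 'o set"
  assumes "galerkin_setting X a Xn"
    and "equivalent_forms X a h' a'"
  shows "(DF inner a (form_kernel X a) Xn \<longleftrightarrow> DF h' a' (form_kernel X a) Xn) \<and>
         (VG inner a X (form_kernel X a) Xn \<longleftrightarrow> VG h' a' X (form_kernel X a) Xn) \<and>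
         (ODF inner X (form_kernel X a) Xn \<longleftrightarrow> ODF h' X (form_kernel X a) Xn)"
proof -
  interpret G: galerkin_setting X a Xn by fact
  interpret A: galerkin_forms X a Xn inner a
    using equivalent_forms_refl[OF G.hilbert_setting_axioms] by unfold_locales
  interpret B: galerkin_forms X a Xn h' a'
    using assms(2) by unfold_locales
  \<comment> \<open>The two orders of the pairs give the two implications of each
    equivalence.\<close>
  interpret AB: galerkin_pair X a Xn inner a h' a' ..
  interpret BA: galerkin_pair X a Xn h' a' inner a ..
  show ?thesis
    using AB.DF_transfer AB.VG_transfer AB.ODF_transfer
      BA.DF_transfer BA.VG_transfer BA.ODF_transfer by blast
qed

end
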